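(* For every real $R\ge 1$, the competitive ratio of the general\&removable online knapsack problem with a buffer of capacity $R$ is at least $1+\frac{1}{R+1}$.
   Context: Online knapsack problem with a resource buffer: there is a knapsack of capacity $1$ and a buffer of capacity $R\ge 1$. Items $e_1,\dots,e_n$ arrive one by one; each item $e$ has size $0<s(e)\le 1$ and value $v(e)\ge 0$; $s(B),v(B)$ denote sums over a set $B$. A deterministic online algorithm maintains buffer contents $B_0=\emptyset,B_1,\dots,B_n$, with $B_i$ chosen after seeing only $e_1,\dots,e_i$, $B_i\subseteq B_{i-1}\cup\{e_i\}$ and $s(B_i)\le R$ (removable setting: items may be discarded from the buffer, but a discarded or rejected item can never re-enter). $\mathrm{ALG}(I)=\max\{v(B)\mid B\subseteq B_n,\ s(B)\le 1\}$, $\mathrm{OPT}(I)=\max\{v(B)\mid B\subseteq\{e_1,\dots,e_n\},\ s(B)\le 1\}$. "General" means values are arbitrary. The competitive ratio of an algorithm is $\sup_I \mathrm{OPT}(I)/\mathrm{ALG}(I)$ (with $a/0=\infty$ for $a>0$), and the competitive ratio of the problem is the infimum of this over all deterministic online algorithms. *)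

theory Defs
  imports Complex_Main "HOL-Library.Extended_Nonnegative_Real"
begin

datatype item = Item (item_size: real) (item_value: real)

definition valid_item :: "item \<Rightarrow> bool" where
  "valid_item e \<longleftrightarrow> 0 < item_size e \<and> item_size e \<le> 1 \<and> 0 \<le> item_value e"

text \<open>
  An input is the list of items in order of arrival. Since distinct items may have equal size and
  value, sets of items are represented by sets of (0-based) positions in the input.
\<close>

definition instances :: "item list set" where
  "instances = {I. \<forall>e\<in>set I. valid_item e}"

definition total_size :: "item list \<Rightarrow> nat set \<Rightarrow> real" where
  "total_size I B = (\<Sum>i\<in>B. item_size (I ! i))"

definition total_value :: "item list \<Rightarrow> nat set \<Rightarrow> real" where
  "total_value I B = (\<Sum>i\<in>B. item_value (I ! i))"

text \<open>
  A deterministic online algorithm maps the sequence of items seen so far to the buffer contents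
  after its last item: on input \<open>I\<close>, the contents after \<open>i\<close> items are \<open>A (take i I)\<close>. The algorithm
  knows \<open>R\<close> but not the length of the whole input.
\<close>

definition online_algorithms :: "real \<Rightarrow> (item list \<Rightarrow> nat set) set" where
  "online_algorithms R = {A.
     A [] = {} \<and>
     (\<forall>I e. I @ [e] \<in> instances \<longrightarrow>
        A (I @ [e]) \<subseteq> A I \<union> {length I} \<and> total_size (I @ [e]) (A (I @ [e])) \<le> R)}"

definition ALG :: "(item list \<Rightarrow> nat set) \<Rightarrow> item list \<Rightarrow> real" where
  "ALG A I = Max {total_value I B | B. B \<subseteq> A I \<and> total_size I B \<le> 1}"

definition OPT :: "item list \<Rightarrow> real" where
  "OPT I = Max {total_value I B | B. B \<subseteq> {..<length I} \<and> total_size I B \<le> 1}"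

text \<open>
  In \<^typ>\<open>ennreal\<close>, \<open>a / 0 = \<infinity>\<close> for \<open>a > 0\<close> and \<open>0 / 0 = 0\<close>. Hence inputs with \<open>OPT I = 0\<close> do not
  contribute to the supremum.
\<close>

definition competitive_ratio :: "(item list \<Rightarrow> nat set) \<Rightarrow> ennreal" where
  "competitive_ratio A = (SUP I\<in>instances. ennreal (OPT I) / ennreal (ALG A I))"

definition problem_competitive_ratio :: "real \<Rightarrow> ennreal" where
  "problem_competitive_ratio R = (INF A\<in>online_algorithms R. competitive_ratio A)"

end

theory Submission
  imports Defs
begin

text \<open>
  With \<open>N = \<lfloor>R\<rfloor> + 1\<close>, the adversary presents items of values \<open>1, \<dots>, N\<close> whose sizes increase and lie
  just below 1, so that together they exceed \<open>R\<close>. Some item \<open>k\<close>, of value \<open>k + 1\<close>, must be dropped,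
  and the adversary then presents an item of value \<open>N - k\<close> that exactly fills the gap left by item
  \<open>k\<close>: the optimum is \<open>N + 1\<close>. The algorithm can combine the new item only with an item smaller, hence
  less valuable, than item \<open>k\<close>, and so gets at most \<open>N\<close>.
\<close>

lemma online_algorithm_subset:
  assumes "A \<in> online_algorithms R" "I \<in> instances"
  shows "A I \<subseteq> {..<length I}"
  using assms(2)
proof (induction I rule: rev_induct)
  case Nil
  then show ?case using assms(1) by (simp add: online_algorithms_def)
next
  case (snoc e I)
  have "I \<in> instances" using snoc.prems by (simp add: instances_def)
  then have "A I \<subseteq> {..<length I}" by (rule snoc.IH)
  moreover have "A (I @ [e]) \<subseteq> A I \<union> {length I}"
    using assms(1) snoc.prems by (simp add: online_algorithms_def)
  ultimately show ?case by auto
qed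

lemma online_algorithm_size:
  assumes "A \<in> online_algorithms R" "I \<in> instances" "I \<noteq> []"
  shows "total_size I (A I) \<le> R"
proof -
  obtain J e where "I = J @ [e]" using assms(3) by (metis rev_exhaust)
  then show ?thesis using assms by (simp add: online_algorithms_def)
qed

lemma ALG_le:
  assumes "finite (A I)"
    and "\<And>B. B \<subseteq> A I \<Longrightarrow> total_size I B \<le> 1 \<Longrightarrow> total_value I B \<le> c"
  shows "ALG A I \<le> c"
  unfolding ALG_def
proof (rule Max.boundedI)
  show "finite {total_value I B |B. B \<subseteq> A I \<and> total_size I B \<le> 1}"
    using assms(1) by simp
  have "{} \<subseteq> A I \<and> total_size I {} \<le> 1" by (simp add: total_size_def)
  then show "{total_value I B |B. B \<subseteq> A I \<and> total_size I B \<le> 1} \<noteq> {}" by blast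
qed (use assms(2) in auto)

lemma OPT_ge:
  assumes "B \<subseteq> {..<length I}" "total_size I B \<le> 1"
  shows "total_value I B \<le> OPT I"
  unfolding OPT_def using assms by (intro Max_ge) auto

text \<open>Reduces the lower bound to one bad instance, with real bounds on both sides of the
  quotient.\<close>

lemma ratio_le_competitive_ratio:
  assumes "I \<in> instances" "a \<le> OPT I" "ALG A I \<le> b" "0 \<le> a" "0 < b"
  shows "ennreal (a / b) \<le> competitive_ratio A"
proof -
  have "ennreal (a / b) \<le> ennreal (OPT I) / ennreal (ALG A I)"
  proof (cases "0 < ALG A I")
    case True
    then have "a / b \<le> OPT I / ALG A I" using assms by (intro frac_le) auto
    then show ?thesis using True assms by (simp add: divide_ennreal ennreal_leI)
  next
    \<comment> \<open>Here \<open>ennreal (ALG A I)\<close> is 0, so the quotient is infinite when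
      \<open>a > 0\<close>; for \<open>a = 0\<close> the left-hand side is 0.\<close>
    case False
    then show ?thesis using assms by (cases "a = 0") (auto simp: ennreal_neg ennreal_divide_zero)
  qed
  also have "\<dots> \<le> competitive_ratio A"
    unfolding competitive_ratio_def using assms(1) by (rule SUP_upper)
  finally show ?thesis .
qed

text \<open>The step \<open>d\<close> between consecutive sizes stays a parameter until
  \<open>R\<close> is known. The largest size is \<open>1 - d\<close>, so even the last item leaves
  a gap to be filled.\<close>

definition increasing_items :: "nat \<Rightarrow> real \<Rightarrow> item list" where
  "increasing_items N d = map (\<lambda>k. Item (1 - d * (real N - real k)) (real k + 1)) [0..<N]"

text \<open>Complements item \<open>k\<close> to size 1 and value \<open>N + 1\<close>.\<close>

definition gap_item :: "nat \<Rightarrow> real \<Rightarrow> nat \<Rightarrow> item" where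
  "gap_item N d k = Item (d * (real N - real k)) (real N - real k)"

lemma length_increasing_items [simp]: "length (increasing_items N d) = N"
  by (simp add: increasing_items_def)

lemma nth_increasing_items [simp]:
  "i < N \<Longrightarrow> increasing_items N d ! i = Item (1 - d * (real N - real i)) (real i + 1)"
  by (simp add: increasing_items_def)

text \<open>The bound 1/4 gives every increasing item size at least 3/4, so no two of them fit
  together.\<close>

lemma small_gap:
  assumes "0 < d" "real N * d \<le> 1 / 4" "k < N"
  shows "0 < d * (real N - real k)" "d * (real N - real k) \<le> 1 / 4"
proof -
  show "0 < d * (real N - real k)" using assms by simp
  have "d * (real N - real k) \<le> d * real N" using assms by (intro mult_left_mono) auto
  then show "d * (real N - real k) \<le> 1 / 4" using assms(2) by (simp add: mult.commute)
qed

lemma increasing_items_instance: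
  assumes "0 < d" "real N * d \<le> 1 / 4"
  shows "increasing_items N d \<in> instances"
proof -
  have "valid_item (increasing_items N d ! i)" if "i < N" for i
    using small_gap[OF assms that] that by (simp add: valid_item_def)
  then show ?thesis by (auto simp: instances_def in_set_conv_nth)
qed

lemma gap_instance:
  assumes "0 < d" "real N * d \<le> 1 / 4" "k < N"
  shows "increasing_items N d @ [gap_item N d k] \<in> instances"
  using increasing_items_instance[OF assms(1,2)] small_gap[OF assms] assms(3)
  by (auto simp: instances_def valid_item_def gap_item_def)

lemma gap_instance_OPT:
  assumes "k < N"
  shows "real N + 1 \<le> OPT (increasing_items N d @ [gap_item N d k])"
proof -
  let ?I = "increasing_items N d @ [gap_item N d k]"
  have "total_value ?I {k, N} \<le> OPT ?I"
    by (rule OPT_ge) (use assms in \<open>auto simp: total_size_def nth_append gap_item_def\<close>)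
  moreover have "total_value ?I {k, N} = real N + 1"
    using assms by (simp add: total_value_def nth_append gap_item_def)
  ultimately show ?thesis by simp
qed

text \<open>A feasible \<open>B\<close> holds at most one increasing item, worth at most
  \<open>N\<close> alone. Beside the gap item it must precede item \<open>k\<close>, which costs at
  least one unit against the optimum \<open>N + 1\<close>.\<close>

lemma gap_instance_value_le:
  fixes N :: nat and d :: real
  defines "I \<equiv> \<lambda>k. increasing_items N d @ [gap_item N d k]"
  assumes d: "0 < d" "real N * d \<le> 1 / 4" and k: "k < N"
    and B: "B \<subseteq> {..N} - {k}" "total_size (I k) B \<le> 1"
  shows "total_value (I k) B \<le> real N"
proof -
  have fin: "finite B" using B(1) by (rule finite_subset) simp
  have old: "I k ! i = Item (1 - d * (real N - real i)) (real i + 1)" if "i < N" for i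
    using that by (simp add: I_def nth_append)
  have new: "I k ! N = Item (d * (real N - real k)) (real N - real k)"
    by (simp add: I_def nth_append gap_item_def)
  have nonneg: "0 \<le> item_size (I k ! i)" if "i \<in> B" for i
  proof (cases "i = N")
    case True
    then show ?thesis using new small_gap(1)[OF d k] by simp
  next
    case False
    then have "i < N" using B(1) that by auto
    then show ?thesis using old small_gap[OF d] by fastforce
  qed
  have sub: "total_size (I k) C \<le> 1" if "C \<subseteq> B" for C
    using sum_mono2[OF fin that, of "\<lambda>i. item_size (I k ! i)"] nonneg B(2)
    by (auto simp: total_size_def)
  have unique: "i = j" if "i \<in> B" "j \<in> B" "i < N" "j < N" for i j
  proof (rule ccontr)
    assume "i \<noteq> j"
    then show False
      using sub[of "{i, j}"] that old small_gap(2)[OF d that(3)] small_gap(2)[OF d that(4)]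
      by (simp add: total_size_def)
  qed
  show ?thesis
  proof (cases "\<exists>i\<in>B. i < N")
    case False
    then have "B \<subseteq> {N}" using B(1) by force
    then have "B = {} \<or> B = {N}" by blast
    then show ?thesis using new by (auto simp: total_value_def)
  next
    case True
    then obtain i where i: "i \<in> B" "i < N" by blast
    have "j = i \<or> j = N" if "j \<in> B" for j
    proof -
      have "j \<le> N" using B(1) that by auto
      then show ?thesis using unique[OF that i(1)] i(2) by linarith
    qed
    then have "B \<subseteq> {i, N}" by blast
    then have "B = {i} \<or> B = {i, N}" using i(1) by blast
    then show ?thesis
    proof
      assume "B = {i}"
      then show ?thesis using i(2) old by (simp add: total_value_def)
    next
      \<comment> \<open>Fitting together means that the gap above item \<open>i\<close> is at least
        the size of the gap item. Hence \<open>i < k\<close>, and the value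
        \<open>(i + 1) + (N - k)\<close> is at most \<open>N\<close>.\<close>
      assume BiN: "B = {i, N}"
      then have "d * (real N - real k) \<le> d * (real N - real i)"
        using B(2) i(2) old new by (simp add: total_size_def)
      then have "i \<le> k" using d(1) by simp
      moreover have "i \<noteq> k" using B(1) i(1) by blast
      ultimately show ?thesis using BiN i(2) old new by (simp add: total_value_def)
    qed
  qed
qed

text \<open>Every size is at least that of the first item, \<open>1 - N * d\<close>.\<close>

lemma increasing_items_size:
  assumes "0 < d"
  shows "real N - real N * (real N * d) \<le> total_size (increasing_items N d) {..<N}"
proof -
  have "real N - real N * (real N * d) = (\<Sum>i<N. 1 - real N * d)"
    by (simp add: right_diff_distrib)
  also have "\<dots> \<le> (\<Sum>i<N. item_size (increasing_items N d ! i))"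
    using assms by (intro sum_mono) (auto simp: algebra_simps)
  finally show ?thesis by (simp add: total_size_def)
qed

lemma competitive_ratio_lower_bound:
  assumes A: "A \<in> online_algorithms R"
    and N: "R < real N" "real N \<le> R + 1" "2 \<le> N"
  shows "ennreal ((real N + 1) / real N) \<le> competitive_ratio A"
proof -
  \<comment> \<open>Chosen so that the total size is at least \<open>N - (N - R) / 2\<close>, the
    midpoint of \<open>R\<close> and \<open>N\<close>, hence above \<open>R\<close>. Since
    \<open>N - R \<le> 1\<close> and \<open>N \<ge> 2\<close>, also
    \<open>N * d \<le> 1 / 4\<close>.\<close>
  define d where "d = (real N - R) / (2 * real N * real N)"
  have d: "0 < d" using N by (simp add: d_def)
  have Nd: "real N * d = (real N - R) / (2 * real N)" using N by (simp add: d_def)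
  also have "\<dots> \<le> 1 / 4" using N by (simp add: field_simps)
  finally have Nd_le: "real N * d \<le> 1 / 4" .
  have "real N * (real N * d) = (real N - R) / 2" unfolding Nd using N by simp
  then have over: "R < total_size (increasing_items N d) {..<N}"
    using increasing_items_size[OF d, of N] N(1) by simp
  let ?J = "increasing_items N d"
  have J: "?J \<in> instances" using d Nd_le by (rule increasing_items_instance)
  have "?J \<noteq> []" using N(3) by (metis length_increasing_items list.size(3) not_numeral_le_zero)
  then have "total_size ?J (A ?J) \<le> R" by (rule online_algorithm_size[OF A J])
  then have "A ?J \<noteq> {..<N}" using over by (metis not_less)
  moreover have AJ: "A ?J \<subseteq> {..<N}" using online_algorithm_subset[OF A J] by simp
  ultimately obtain k where k: "k < N" "k \<notin> A ?J" by blast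
  let ?I = "?J @ [gap_item N d k]"
  have I: "?I \<in> instances" using d Nd_le k(1) by (rule gap_instance)
  have "A ?I \<subseteq> A ?J \<union> {length ?J}"
    using A I unfolding online_algorithms_def by blast
  \<comment> \<open>Position \<open>k\<close> cannot re-enter, and the new item has position
    \<open>N\<close>, which differs from \<open>k\<close>.\<close>
  then have AI: "A ?I \<subseteq> {..N} - {k}" using AJ k by force
  have "ALG A ?I \<le> real N"
  proof (rule ALG_le)
    show "finite (A ?I)" using AI by (rule finite_subset) simp
  qed (use AI gap_instance_value_le[OF d Nd_le k(1)] in blast)
  then show ?thesis
    using N(3) by (intro ratio_le_competitive_ratio[OF I gap_instance_OPT[OF k(1)]]) auto
qed

theorem theorem5:
  fixes R :: real
  assumes "R \<ge> 1"
  shows "problem_competitive_ratio R \<ge> ennreal (1 + 1 / (R + 1))"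
  unfolding problem_competitive_ratio_def
proof (rule INF_greatest)
  fix A assume A: "A \<in> online_algorithms R"
  \<comment> \<open>The least integer strictly above \<open>R\<close>, also when \<open>R\<close> is
    an integer; \<open>N \<le> R + 1\<close> turns \<open>1 + 1 / N\<close> into the claimed
    bound.\<close>
  define N where "N = nat (\<lfloor>R\<rfloor> + 1)"
  have "real N = real_of_int \<lfloor>R\<rfloor> + 1" using assms by (simp add: N_def)
  then have N: "R < real N" "real N \<le> R + 1" by linarith+
  then have N2: "2 \<le> N" using assms by linarith
  have "1 + 1 / (R + 1) \<le> (real N + 1) / real N"
    using N assms by (simp add: field_simps)
  then have "ennreal (1 + 1 / (R + 1)) \<le> ennreal ((real N + 1) / real N)"
    by (rule ennreal_leI)
  also have "\<dots> \<le> competitive_ratio A"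
    using A N N2 by (rule competitive_ratio_lower_bound)
  finally show "ennreal (1 + 1 / (R + 1)) \<le> competitive_ratio A" .
qed

end
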